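(* Consider the order-assignment model described in the context, with any number of workers $N\ge 1$ and any busy time $b\ge 1$ (hence any degree of oversupply $\deg=N/b$). For all $\alpha\in(0,1]$ with $\alpha N\in\mathbb{N}$ and all thresholds $\tau>r$ (with $(\tau-r)/\delta\in\mathbb{N}$), the gain of collective action $G(\alpha,\tau):=u(\alpha,\tau)-u^{\mathrm{base}}$ satisfies $$G(\alpha,\tau)>0 .$$
   Context: Model. Parameters: integers $N\ge1$ (workers) and $b\ge1$ (busy time); reals $r>0$ (base pay), $\delta>0$ (pay increment), $c,m\ge0$ (cost per mile, miles per order), $n>0$ (orders per hour); a threshold $\tau\ge r$ such that $Z:=(\tau-r)/\delta$ is a nonnegative integer; a fraction $\alpha\in[0,1]$ with $\alpha N$ an integer. Exactly $\alpha N$ of the workers are participants, the other $(1-\alpha)N$ are non-participants. Dynamics. Time is discrete, with one incoming order per time step $t$. Each worker is idle or busy. If at least one worker is idle at step $t$, the order is offered, at pay $r$, to a uniformly random idle worker. A non-participant accepts at any pay; a participant accepts iff the current pay is at least $\tau$ and otherwise declines. After each decline the pay rises by $\delta$ and the order is offered again to an independently, uniformly chosen idle worker (possibly the same one), within the same time step, until accepted. A worker accepting the order of step $t$ is busy for $b$ time steps: unavailable for the orders of steps $t+1,\dots,t+b-1$ and idle again for the order of step $t+b$. If no worker is idle at step $t$, the order of step $t$ is lost. The process starts from an arbitrary fixed initial configuration (every initially busy worker becoming idle within $b$ steps). Let $I_t=1$ if some worker is idle at step $t$ and $I_t=0$ otherwise. When $I_t=1$, let $q_t$ be the fraction of participants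 among the workers idle at step $t$ (before assignment), and let $\beta_t:=q_t^{Z+1}$, the conditional probability that a participant accepts the order. For $q_t<1$ let $$R_t:=\sum_{z=0}^{Z} z\delta\,\frac{q_t^z(1-q_t)}{1-q_t^{Z+1}},$$ the expected pay increase over $r$ given that a non-participant accepts; the product $(1-\beta_t)R_t$ is read as $0$ when $q_t=1$. Any product containing the factor $I_t$ is $0$ when $I_t=0$. For a quantity $X_t$ depending on the state at step $t$, $\mathbb{E}_t[X_t]:=\lim_{T\to\infty}\frac1T\sum_{t=1}^T\mathbb{E}[X_t]$ (long-run average). Put $R:=\mathbb{E}_t[(1-\beta_t)R_tI_t]$. Utilities (expected hourly income per worker): $$u^D(\alpha,\tau):=\frac{1}{\alpha N}(\tau-cm)\,n\,\mathbb{E}_t[\beta_tI_t]\quad(\alpha>0),$$ $$u^A(\alpha,\tau):=\frac{1}{(1-\alpha)N}(r-cm)\,n\,\mathbb{E}_t[(1-\beta_t)I_t]+\frac{n}{(1-\alpha)N}R\quad(\alpha<1),$$ for participants and non-participants respectively, and the average utility is $u(\alpha,\tau):=\alpha u^D(\alpha,\tau)+(1-\alpha)u^A(\alpha,\tau)$, where the term of an empty group is taken to be $0$. The base utility $u^{\mathrm{base}}$ is the average utility in the same model without any strategy, i.e. with $\alpha=0$ (every worker accepts every offered order at pay $r$): $u^{\mathrm{base}}=\frac1N(r-cm)\,n\,\mathbb{E}_t[I_t]$, with $\mathbb{E}_t[I_t]$ computed for $\alpha=0$. *)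

theory Defs
  imports "HOL-Probability.Probability"
begin

text \<open>
  The workers are the elements of a finite type \<open>'w\<close>, so that \<open>N = CARD('w)\<close>; the participants
  form a set \<open>P\<close> of workers. A configuration \<open>s\<close>, taken just before the order of a time step,
  assigns to every worker the number of steps until he becomes idle; idle workers have the
  value \<open>0\<close>.
\<close>

type_synonym 'w config = "'w \<Rightarrow> nat"

definition idle :: "'w config \<Rightarrow> 'w set" where
  "idle s = {w. s w = 0}"

definition accepts :: "real \<Rightarrow> 'w set \<Rightarrow> 'w \<Rightarrow> real \<Rightarrow> bool" where
  "accepts \<tau> P w pay \<longleftrightarrow> (w \<in> P \<longrightarrow> pay \<ge> \<tau>)"

definition long_run_avg :: "(nat \<Rightarrow> real) \<Rightarrow> real" where
  "long_run_avg x = lim (\<lambda>T. (\<Sum>t=1..T. x t) / real T)"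

locale order_model =
  fixes b :: nat and r \<delta> c m n :: real
  assumes busy_time: "b \<ge> 1"
    and base_pay: "r > 0"
    and increment: "\<delta> > 0"
    and cost_per_mile: "c \<ge> 0"
    and miles_per_order: "m \<ge> 0"
    and orders_per_hour: "n > 0"
begin

text \<open>
  The law of the worker from \<open>A\<close> who finally accepts an order that is currently offered at
  the given pay.
\<close>

function offer :: "real \<Rightarrow> 'w set \<Rightarrow> 'w set \<Rightarrow> real \<Rightarrow> 'w pmf" where
  "offer \<tau> P A pay =
     bind_pmf (pmf_of_set A)
       (\<lambda>w. if accepts \<tau> P w pay then return_pmf w else offer \<tau> P A (pay + \<delta>))"
  by auto
termination
proof (relation "Wellfounded.measure (\<lambda>(\<tau>, P, A, pay). nat \<lceil>(\<tau> - pay) / \<delta>\<rceil>)", goal_cases)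
  case (2 \<tau> P A pay w)
  have "(\<tau> - (pay + \<delta>)) / \<delta> = (\<tau> - pay) / \<delta> - 1"
    using increment by (simp add: field_simps)
  moreover have "(\<tau> - pay) / \<delta> > 0"
    using 2 increment by (auto simp: accepts_def)
  ultimately show ?case
    by simp
qed simp

declare offer.simps [simp del]

text \<open>
  Passing from one step to the next uses up one step of busy time, so a worker who has just
  accepted has \<open>b - 1\<close> steps left.
\<close>

definition step :: "real \<Rightarrow> 'w set \<Rightarrow> 'w config \<Rightarrow> 'w config pmf" where
  "step \<tau> P s =
     (if idle s = {} then return_pmf (\<lambda>v. s v - 1)
      else map_pmf (\<lambda>w. (\<lambda>v. s v - 1)(w := b - 1)) (offer \<tau> P (idle s) r))"

text \<open>The law of the configuration at step \<open>t \<ge> 1\<close>, where \<open>s0\<close> is the one at step \<open>1\<close>.\<close>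

definition config_at :: "real \<Rightarrow> 'w set \<Rightarrow> 'w config \<Rightarrow> nat \<Rightarrow> 'w config pmf" where
  "config_at \<tau> P s0 t = ((\<lambda>M. bind_pmf M (step \<tau> P)) ^^ (t - 1)) (return_pmf s0)"

definition Et :: "real \<Rightarrow> 'w set \<Rightarrow> 'w config \<Rightarrow> ('w config \<Rightarrow> real) \<Rightarrow> real" where
  "Et \<tau> P s0 X = long_run_avg (\<lambda>t. measure_pmf.expectation (config_at \<tau> P s0 t) X)"

definition Z :: "real \<Rightarrow> nat" where
  "Z \<tau> = nat \<lfloor>(\<tau> - r) / \<delta>\<rfloor>"

definition I :: "'w config \<Rightarrow> real" where
  "I s = (if idle s \<noteq> {} then 1 else 0)"

definition q :: "'w set \<Rightarrow> 'w config \<Rightarrow> real" where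
  "q P s = real (card (idle s \<inter> P)) / real (card (idle s))"

definition \<beta> :: "real \<Rightarrow> 'w set \<Rightarrow> 'w config \<Rightarrow> real" where
  "\<beta> \<tau> P s = q P s ^ (Z \<tau> + 1)"

text \<open>
  For \<open>q P s = 1\<close> the denominator vanishes; this value is only used multiplied by
  \<open>1 - \<beta> \<tau> P s = 0\<close>.
\<close>

definition R :: "real \<Rightarrow> 'w set \<Rightarrow> 'w config \<Rightarrow> real" where
  "R \<tau> P s = (\<Sum>z\<le>Z \<tau>. real z * \<delta> * (q P s ^ z * (1 - q P s) / (1 - q P s ^ (Z \<tau> + 1))))"

definition frac :: "'w::finite set \<Rightarrow> real" where
  "frac P = real (card P) / real CARD('w)"

definition uD :: "real \<Rightarrow> 'w::finite set \<Rightarrow> 'w config \<Rightarrow> real" where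
  "uD \<tau> P s0 =
     1 / (frac P * real CARD('w)) * (\<tau> - c * m) * n * Et \<tau> P s0 (\<lambda>s. \<beta> \<tau> P s * I s)"

definition uA :: "real \<Rightarrow> 'w::finite set \<Rightarrow> 'w config \<Rightarrow> real" where
  "uA \<tau> P s0 =
     1 / ((1 - frac P) * real CARD('w)) * (r - c * m) * n * Et \<tau> P s0 (\<lambda>s. (1 - \<beta> \<tau> P s) * I s)
     + n / ((1 - frac P) * real CARD('w)) * Et \<tau> P s0 (\<lambda>s. (1 - \<beta> \<tau> P s) * R \<tau> P s * I s)"

definition u :: "real \<Rightarrow> 'w::finite set \<Rightarrow> 'w config \<Rightarrow> real" where
  "u \<tau> P s0 = frac P * uD \<tau> P s0 + (1 - frac P) * uA \<tau> P s0"

text \<open>Without participants the threshold is irrelevant; \<open>r\<close> is a dummy value.\<close>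

definition u_base :: "'w::finite config \<Rightarrow> real" where
  "u_base s0 = 1 / real CARD('w) * (r - c * m) * n * Et r {} s0 I"

lemma u_no_participants:
  fixes s0 :: "'w::finite config"
  shows "u \<tau> {} s0 = u_base s0"
proof -
  have "offer \<tau> {} A r = offer r {} A r" for A :: "'w set"
    by (simp add: offer.simps[of _ _ _ r] accepts_def)
  then have "step \<tau> {} = (step r {} :: 'w config \<Rightarrow> _)"
    by (intro ext) (simp add: step_def del: One_nat_def)
  then have E: "Et \<tau> {} s0 X = Et r {} s0 X" for X
    by (simp add: Et_def config_at_def)
  have "R \<tau> {} s = 0" for s :: "'w config"
    unfolding R_def by (intro sum.neutral) (auto simp: q_def power_0_left)
  then have "Et \<tau> {} s0 (\<lambda>s. (1 - \<beta> \<tau> {} s) * R \<tau> {} s * I s) = 0"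
    by (simp add: Et_def long_run_avg_def)
  moreover have "(\<lambda>s :: 'w config. (1 - \<beta> \<tau> {} s) * I s) = I"
    by (simp add: \<beta>_def q_def)
  ultimately show ?thesis
    by (simp add: u_def uA_def u_base_def frac_def E)
qed

text \<open>
  The two utilities are long-run quantities of two separate runs of the model, each with its
  own initial configuration.
\<close>

definition gain :: "real \<Rightarrow> 'w::finite set \<Rightarrow> 'w config \<Rightarrow> 'w config \<Rightarrow> real" where
  "gain \<tau> P s0 s0_base = u \<tau> P s0 - u_base s0_base"

end

end

theory Submission
  imports Defs
begin

text \<open>
  Whichever idle worker takes an order, the number of idle workers evolves in the same way, so
  the long-run fraction of served orders is \<open>min 1 (N / b)\<close> with or without participants. In the
  gain the base pay therefore cancels, and what remains is the average pay increase
  \<open>((\<tau> - r) \<beta> + (1 - \<beta>) R) I = \<delta> (q + \<dots> + q^Z) I \<ge> \<delta> q I\<close>. It is positive because a participant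
  is idle at least once in any \<open>b\<close> consecutive steps. All averages exist by the mean ergodic theorem
  for finite Markov chains, and both rates come from the fact that the drift of a function along a
  finite chain averages to zero.
\<close>

section \<open>Ergodic averages of finite Markov chains\<close>

locale finite_markov_chain =
  fixes K :: "'s \<Rightarrow> 's pmf" and S :: "'s set" and init :: 's
  assumes finite_states: "finite S"
    and init_state: "init \<in> S"
    and closed: "s \<in> S \<Longrightarrow> set_pmf (K s) \<subseteq> S"
begin

definition law :: "nat \<Rightarrow> 's pmf" where
  "law t = ((\<lambda>M. bind_pmf M K) ^^ t) (return_pmf init)"

abbreviation expect :: "nat \<Rightarrow> ('s \<Rightarrow> real) \<Rightarrow> real" where
  "expect t X \<equiv> measure_pmf.expectation (law t) X"

definition transfer :: "('s \<Rightarrow> real) \<Rightarrow> 's \<Rightarrow> real" where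
  "transfer X s = measure_pmf.expectation (K s) X"

definition avg :: "('s \<Rightarrow> real) \<Rightarrow> nat \<Rightarrow> real" where
  "avg X T = (\<Sum>t<T. expect t X) / real T"

definition lim_avg :: "('s \<Rightarrow> real) \<Rightarrow> real" where
  "lim_avg X = lim (avg X)"

section \<open>Expectations and averages over finitely many steps\<close>

lemma law_0 [simp]: "law 0 = return_pmf init"
  and law_Suc [simp]: "law (Suc t) = bind_pmf (law t) K"
  by (simp_all add: law_def)

lemma set_law: "set_pmf (law t) \<subseteq> S"
  by (induction t) (use init_state closed in auto)

lemma finite_set_law: "finite (set_pmf (law t))"
  using set_law finite_states by (rule finite_subset)

lemma set_law_induct [consumes 1, case_names init step]:
  assumes "s \<in> set_pmf (law t)"
    and "Q 0 init"
    and "\<And>t s s'. s \<in> S \<Longrightarrow> Q t s \<Longrightarrow> s' \<in> set_pmf (K s) \<Longrightarrow> Q (Suc t) s'"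
  shows "Q t s"
  using assms(1)
proof (induction t arbitrary: s)
  case 0
  then show ?case
    using assms(2) by simp
next
  case (Suc t)
  then obtain s1 where "s1 \<in> set_pmf (law t)" "s \<in> set_pmf (K s1)"
    by auto
  then show ?case
    using Suc.IH set_law assms(3) by blast
qed

lemma expect_eq_sum: "expect t X = (\<Sum>s\<in>S. X s * pmf (law t) s)"
  using set_law by (intro integral_measure_pmf_real finite_states) auto

lemma transfer_eq_sum: "s \<in> S \<Longrightarrow> transfer X s = (\<Sum>s'\<in>S. X s' * pmf (K s) s')"
  unfolding transfer_def using closed by (intro integral_measure_pmf_real finite_states) auto

lemma expect_Suc: "expect (Suc t) X = expect t (transfer X)"
proof -
  have "expect (Suc t) X = (\<Sum>s\<in>S. pmf (law t) s *\<^sub>R measure_pmf.expectation (K s) X)"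
    unfolding law_Suc
    by (rule pmf_expectation_bind)
      (use finite_states set_law finite_subset[OF closed] in auto)
  then show ?thesis
    by (simp add: expect_eq_sum[of t] transfer_def mult.commute)
qed

lemma expect_mono:
  assumes "\<And>s. s \<in> set_pmf (law t) \<Longrightarrow> X s \<le> Y s"
  shows "expect t X \<le> expect t Y"
  using assms by (intro integral_mono_AE integrable_measure_pmf_finite finite_set_law)
    (simp add: AE_measure_pmf_iff)

lemma expect_cong:
  assumes "\<And>s. s \<in> set_pmf (law t) \<Longrightarrow> X s = Y s"
  shows "expect t X = expect t Y"
  using assms by (intro antisym expect_mono) auto

lemma expect_add: "expect t (\<lambda>s. X s + Y s) = expect t X + expect t Y"
  by (simp add: expect_eq_sum sum.distrib algebra_simps)

lemma avg_add: "avg (\<lambda>s. X s + Y s) T = avg X T + avg Y T"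
  by (simp add: avg_def expect_add sum.distrib add_divide_distrib del: Bochner_Integration.integral_add)

lemma avg_mult: "avg (\<lambda>s. a * X s) T = a * avg X T"
  by (simp add: avg_def flip: sum_distrib_left)

lemma avg_const: "T > 0 \<Longrightarrow> avg (\<lambda>s. a) T = a"
  by (simp add: avg_def)

lemma avg_mono:
  assumes "\<And>t s. s \<in> set_pmf (law t) \<Longrightarrow> X s \<le> Y s"
  shows "avg X T \<le> avg Y T"
  unfolding avg_def by (intro divide_right_mono sum_mono expect_mono assms) auto

text \<open>Applying \<open>transfer\<close> shifts time by one, so the two sums differ only in
  boundary terms, which stay bounded because \<open>S\<close> is finite.\<close>

lemma avg_transfer_diff: "(\<lambda>T. avg (transfer X) T - avg X T) \<longlonglongrightarrow> 0"
proof -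
  define C where "C = (\<Sum>s\<in>S. \<bar>X s\<bar>)"
  have bound: "\<bar>expect t X\<bar> \<le> C" for t
  proof -
    have "\<bar>X s * pmf (law t) s\<bar> \<le> \<bar>X s\<bar>" for s
      by (simp add: abs_mult mult_left_le pmf_le_1)
    then show ?thesis
      unfolding expect_eq_sum C_def by (intro order.trans[OF sum_abs] sum_mono)
  qed
  have "avg (transfer X) T - avg X T = (expect T X - expect 0 X) / real T" for T
    unfolding sum_lessThan_telescope[of "\<lambda>t. expect t X" T, symmetric]
    by (simp only: avg_def expect_Suc diff_divide_distrib sum_subtractf)
  moreover have "\<bar>expect T X - expect 0 X\<bar> \<le> 2 * C" for T
    using bound[of T] bound[of 0] by linarith
  ultimately have "norm (avg (transfer X) T - avg X T) \<le> 2 * C / real T" for T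
    by (simp add: divide_right_mono)
  then show ?thesis
    by (intro Lim_null_comparison[OF _ lim_const_over_n[of "2 * C"]] always_eventually) blast
qed

lemma avg_transfer_iter_diff: "(\<lambda>T. avg ((transfer ^^ k) X) T - avg X T) \<longlonglongrightarrow> 0"
proof (induction k)
  case (Suc k)
  show ?case
    using tendsto_add[OF avg_transfer_diff[of "(transfer ^^ k) X"] Suc.IH] by simp
qed simp

text \<open>
  Mean ergodic theorem: a limit point \<open>h\<close> of the Cesaro means of the iterates of \<open>transfer\<close> is
  harmonic, so that its averages are constant, while each Cesaro mean of \<open>X\<close> has asymptotically
  the same averages as \<open>X\<close> itself.
\<close>

lemma avg_convergent: "convergent (avg X)"
proof -
  define C where "C = (\<Sum>s\<in>S. \<bar>X s\<bar>)"
  define M where "M k s = (\<Sum>j<k. (transfer ^^ j) X s) / real k" for k s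
  have iter_bound: "\<bar>(transfer ^^ k) X s\<bar> \<le> C" if "s \<in> S" for k s
    using that
  proof (induction k arbitrary: s)
    case 0
    then show ?case
      unfolding C_def using finite_states by (simp add: member_le_sum[of s S "\<lambda>s. \<bar>X s\<bar>"])
  next
    case (Suc k)
    have "\<bar>(transfer ^^ Suc k) X s\<bar> \<le> (\<Sum>s'\<in>S. \<bar>(transfer ^^ k) X s' * pmf (K s) s'\<bar>)"
      using Suc.prems by (simp add: transfer_eq_sum)
    also have "\<dots> \<le> (\<Sum>s'\<in>S. C * pmf (K s) s')"
      using Suc.IH by (intro sum_mono) (simp add: abs_mult mult_right_mono)
    also have "\<dots> = C"
      using sum_pmf_eq_1[OF finite_states closed[OF Suc.prems]] by (simp flip: sum_distrib_left)
    finally show ?case .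
  qed
  have M_bound: "\<bar>M k s\<bar> \<le> C" if "s \<in> S" for k s
  proof (cases "k = 0")
    case True
    then show ?thesis
      using iter_bound[OF that, of 0] by (simp add: M_def)
  next
    case False
    have "\<bar>\<Sum>j<k. (transfer ^^ j) X s\<bar> \<le> (\<Sum>j<k. C)"
      using iter_bound[OF that] by (intro order.trans[OF sum_abs] sum_mono)
    then show ?thesis
      using False by (simp add: M_def field_simps)
  qed
  \<comment> \<open>Bolzano-Weierstrass in finitely many coordinates: one subsequence converges at
    all states of \<open>S\<close> at once.\<close>
  have "\<forall>D\<subseteq>S. \<exists>l::'s \<Rightarrow> real. \<exists>\<rho>::nat \<Rightarrow> nat. strict_mono \<rho> \<and>
      (\<forall>e>0. eventually (\<lambda>k. \<forall>s\<in>D. dist (M (\<rho> k) s) (l s) < e) sequentially)"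
    by (rule compact_lemma_general[where unproj = "\<lambda>e. e"])
      (use finite_states M_bound in \<open>auto simp: bounded_iff\<close>)
  then obtain h \<rho> where "strict_mono \<rho>"
    and h: "\<And>e. e > 0 \<Longrightarrow> eventually (\<lambda>k. \<forall>s\<in>S. dist (M (\<rho> k) s) (h s) < e) sequentially"
    by blast
  have M_lim: "(\<lambda>k. M (\<rho> k) s) \<longlonglongrightarrow> h s" if "s \<in> S" for s
    unfolding tendsto_iff using h that by (fastforce elim: eventually_mono)
  \<comment> \<open>Telescoping makes \<open>M k\<close> invariant up to \<open>2 * C / k\<close>;
    on \<open>S\<close>, \<open>transfer\<close> is a finite sum, so invariance passes to the
    limit.\<close>
  have harmonic: "transfer h s = h s" if s: "s \<in> S" for s
  proof -
    have "transfer (M k) s - M k s = ((transfer ^^ k) X s - X s) / real k" for k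
    proof -
      have "transfer (M k) s = (\<Sum>j<k. (transfer ^^ Suc j) X s) / real k"
        unfolding M_def using s
        by (simp add: transfer_eq_sum sum_distrib_right sum_divide_distrib) (subst sum.swap, simp)
      then have "transfer (M k) s - M k s =
          (\<Sum>j<k. (transfer ^^ Suc j) X s - (transfer ^^ j) X s) / real k"
        by (simp only: M_def diff_divide_distrib sum_subtractf)
      then show ?thesis
        unfolding sum_lessThan_telescope[of "\<lambda>j. (transfer ^^ j) X s"] by simp
    qed
    moreover have "\<bar>(transfer ^^ k) X s - X s\<bar> \<le> 2 * C" for k
      using iter_bound[OF s, of k] iter_bound[OF s, of 0] by simp
    ultimately have "norm (transfer (M k) s - M k s) \<le> 2 * C / real k" for k
      by (simp add: divide_right_mono)
    then have "(\<lambda>k. transfer (M k) s - M k s) \<longlonglongrightarrow> 0"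
      by (intro Lim_null_comparison[OF _ lim_const_over_n[of "2 * C"]] always_eventually) blast
    from LIMSEQ_subseq_LIMSEQ[OF this \<open>strict_mono \<rho>\<close>]
    have "(\<lambda>k. transfer (M (\<rho> k)) s - M (\<rho> k) s) \<longlonglongrightarrow> 0"
      by (simp add: o_def)
    moreover have "(\<lambda>k. transfer (M (\<rho> k)) s - M (\<rho> k) s) \<longlonglongrightarrow> transfer h s - h s"
      using s by (auto simp: transfer_eq_sum intro!: tendsto_intros M_lim)
    ultimately show ?thesis
      using LIMSEQ_unique by fastforce
  qed
  have expect_h: "expect t h = h init" for t
  proof (induction t)
    case (Suc t)
    have "expect t (transfer h) = expect t h"
      using set_law harmonic by (intro expect_cong) auto
    then show ?case
      unfolding expect_Suc by (simp add: Suc.IH)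
  qed simp
  have avg_M: "(\<lambda>T. avg (M k) T - avg X T) \<longlonglongrightarrow> 0" if "k > 0" for k
  proof -
    have "avg (M k) T - avg X T = (\<Sum>j<k. avg ((transfer ^^ j) X) T - avg X T) / real k" for T
    proof -
      have "expect t (M k) = (\<Sum>j<k. expect t ((transfer ^^ j) X)) / real k" for t
        unfolding M_def expect_eq_sum
        by (simp add: sum_distrib_right sum_divide_distrib) (subst sum.swap, simp)
      then have "avg (M k) T = (\<Sum>t<T. \<Sum>j<k. expect t ((transfer ^^ j) X)) / real k / real T"
        by (simp add: avg_def flip: sum_divide_distrib)
      also have "\<dots> = (\<Sum>j<k. avg ((transfer ^^ j) X) T) / real k"
        by (subst sum.swap) (simp add: avg_def flip: sum_divide_distrib)
      finally have "avg (M k) T = (\<Sum>j<k. avg ((transfer ^^ j) X) T) / real k" .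
      then show ?thesis
        using that by (simp add: sum_subtractf diff_divide_distrib)
    qed
    moreover have "(\<lambda>T. (\<Sum>j<k. avg ((transfer ^^ j) X) T - avg X T) / real k)
        \<longlonglongrightarrow> (\<Sum>j<k. 0) / real k"
      by (intro tendsto_divide tendsto_sum avg_transfer_iter_diff tendsto_const)
        (use that in simp)
    ultimately show ?thesis
      by simp
  qed
  have "avg X \<longlonglongrightarrow> h init"
    unfolding tendsto_iff
  proof (intro allI impI)
    fix e :: real
    assume "e > 0"
    \<comment> \<open>Requiring \<open>k > 0\<close> makes \<open>\<rho> k\<close> positive: the
      empty mean \<open>M 0\<close> is 0 by division by zero and is excluded from
      \<open>avg_M\<close>.\<close>
    have "eventually (\<lambda>k. (\<forall>s\<in>S. dist (M (\<rho> k) s) (h s) < e / 2) \<and> k > 0) sequentially"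
      using \<open>e > 0\<close> by (intro eventually_conj h eventually_gt_at_top) simp
    then obtain k where k: "\<And>s. s \<in> S \<Longrightarrow> dist (M (\<rho> k) s) (h s) < e / 2" "k > 0"
      using eventually_happens'[OF sequentially_bot] by blast
    have "\<rho> k > 0"
      using seq_suble[OF \<open>strict_mono \<rho>\<close>, of k] k(2) by simp
    then have "eventually (\<lambda>T. dist (avg (M (\<rho> k)) T - avg X T) 0 < e / 2) sequentially"
      using \<open>e > 0\<close> by (intro tendstoD avg_M) auto
    then show "eventually (\<lambda>T. dist (avg X T) (h init) < e) sequentially"
      using eventually_gt_at_top[of 0]
    proof eventually_elim
      case (elim T)
      \<comment> \<open>The lower bound is written as a sum so that \<open>avg_add\<close> and
        \<open>avg_const\<close> apply to it.\<close>
      have close: "h s + (- e / 2) \<le> M (\<rho> k) s" "M (\<rho> k) s \<le> h s + e / 2" if "s \<in> S" for s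
        using k(1)[OF that] unfolding dist_real_def by linarith+
      have "avg (M (\<rho> k)) T \<le> avg (\<lambda>s. h s + e / 2) T"
        "avg (\<lambda>s. h s + (- e / 2)) T \<le> avg (M (\<rho> k)) T"
        using close set_law by (auto intro!: avg_mono simp del: minus_divide_left)
      moreover have "avg h T = h init"
        using \<open>0 < T\<close> by (simp add: avg_def expect_h)
      ultimately have "\<bar>avg (M (\<rho> k)) T - h init\<bar> \<le> e / 2"
        using \<open>0 < T\<close> by (simp only: avg_add avg_const abs_le_iff) linarith
      then show ?case
        using elim(1) unfolding dist_real_def by linarith
    qed
  qed
  then show ?thesis
    by (rule convergentI)
qed

section \<open>Calculus of long-run averages\<close>

lemma avg_lim_avg: "avg X \<longlonglongrightarrow> lim_avg X"
  unfolding lim_avg_def using avg_convergent by (simp add: convergent_LIMSEQ_iff)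

lemma lim_avg_eqI: "avg X \<longlonglongrightarrow> l \<Longrightarrow> lim_avg X = l"
  using avg_lim_avg LIMSEQ_unique by blast

lemma lim_avg_add: "lim_avg (\<lambda>s. X s + Y s) = lim_avg X + lim_avg Y"
  by (intro lim_avg_eqI) (simp add: avg_add[abs_def] tendsto_add avg_lim_avg)

lemma lim_avg_mult: "lim_avg (\<lambda>s. a * X s) = a * lim_avg X"
  by (intro lim_avg_eqI) (simp add: avg_mult[abs_def] tendsto_mult avg_lim_avg)

lemma lim_avg_const [simp]: "lim_avg (\<lambda>s. a) = a"
  by (intro lim_avg_eqI tendsto_eventually eventually_mono[OF eventually_gt_at_top[of 0]] avg_const)

lemma lim_avg_transfer: "lim_avg (transfer X) = lim_avg X"
  using LIMSEQ_unique[OF avg_transfer_diff tendsto_diff[OF avg_lim_avg avg_lim_avg]] by simp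

text \<open>The steps before \<open>t0\<close> contribute at most a constant to the sums, which
  vanishes after division by \<open>T\<close>. Thus invariants that hold only eventually
  suffice.\<close>

lemma lim_avg_mono:
  assumes "\<And>t s. t \<ge> t0 \<Longrightarrow> s \<in> set_pmf (law t) \<Longrightarrow> X s \<le> Y s"
  shows "lim_avg X \<le> lim_avg Y"
proof -
  define C where "C = (\<Sum>t<t0. \<bar>expect t X - expect t Y\<bar>)"
  have "avg X T \<le> avg Y T + C / real T" for T
  proof -
    have "(\<Sum>t<T. expect t X - expect t Y) \<le> (\<Sum>t\<in>{..<T} \<inter> {..<t0}. \<bar>expect t X - expect t Y\<bar>)"
      unfolding sum.inter_restrict[OF finite_lessThan]
      by (intro sum_mono) (use assms expect_mono[of _ X Y] in \<open>auto simp: not_less\<close>)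
    also have "\<dots> \<le> C"
      unfolding C_def by (intro sum_mono2) auto
    finally show ?thesis
      by (simp add: avg_def sum_subtractf divide_right_mono flip: add_divide_distrib)
  qed
  moreover have "(\<lambda>T. avg Y T + C / real T) \<longlonglongrightarrow> lim_avg Y + 0"
    by (intro tendsto_add avg_lim_avg lim_const_over_n)
  ultimately show ?thesis
    using LIMSEQ_le[OF avg_lim_avg] by fastforce
qed

lemma lim_avg_cong:
  assumes "\<And>t s. t \<ge> t0 \<Longrightarrow> s \<in> set_pmf (law t) \<Longrightarrow> X s = Y s"
  shows "lim_avg X = lim_avg Y"
  using assms by (intro antisym lim_avg_mono[of t0]) auto

text \<open>\<open>W\<close> has the same long-run average before and after a transition, so an
  upper bound on its increments cannot average below zero. Using both \<open>W\<close> and its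
  negative turns an exact increment into a balance equation.\<close>

lemma lim_avg_drift:
  assumes "\<And>s s'. s \<in> S \<Longrightarrow> s' \<in> set_pmf (K s) \<Longrightarrow> W s' \<le> W s + D s"
  shows "0 \<le> lim_avg D"
proof -
  have "transfer W s \<le> W s + D s" if "s \<in> S" for s
  proof -
    have "transfer W s \<le> measure_pmf.expectation (K s) (\<lambda>s'. W s + D s)"
      unfolding transfer_def using assms that closed[OF that] finite_states
      by (intro integral_mono_AE integrable_measure_pmf_finite)
        (auto simp: AE_measure_pmf_iff intro: finite_subset)
    then show ?thesis
      by simp
  qed
  then have "lim_avg (transfer W) \<le> lim_avg (\<lambda>s. W s + D s)"
    using set_law by (intro lim_avg_mono[of 0]) blast
  then show ?thesis
    by (simp add: lim_avg_transfer lim_avg_add)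
qed

end

section \<open>Invariants of the configurations\<close>

context order_model
begin

text \<open>The bound is \<open>b\<close>, not \<open>b - 1\<close>, because an initial
  configuration may contain \<open>b\<close>.\<close>

definition configs :: "'w config set" where
  "configs = {s. \<forall>w. s w \<le> b}"

lemma finite_configs: "finite (configs :: 'w::finite config set)"
proof -
  have "configs = (UNIV :: 'w set) \<rightarrow>\<^sub>E {..b}"
    by (auto simp: configs_def PiE_def)
  then show ?thesis
    by (simp add: finite_PiE)
qed

section \<open>One step of the dynamics and its invariants\<close>

lemma set_offer:
  assumes "finite A" "A \<noteq> {}"
  shows "set_pmf (offer \<tau> P A pay) \<subseteq> A"
  using assms
proof (induction \<tau> P A pay rule: offer.induct)
  case (1 \<tau> P A pay)
  then show ?case
    by (subst offer.simps) (simp add: UN_subset_iff)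
qed

text \<open>All later facts about the dynamics use only that some idle worker takes the order, not
  which one; hence they do not depend on \<open>\<tau>\<close> and \<open>P\<close>.\<close>

lemma step_cases:
  fixes s :: "'w::finite config"
  assumes "s' \<in> set_pmf (step \<tau> P s)"
  obtains (lost) "idle s = {}" "s' = (\<lambda>v. s v - 1)"
    | (taken) w where "w \<in> idle s" "s' = (\<lambda>v. s v - 1)(w := b - 1)"
  using assms set_offer[of "idle s" \<tau> P r] by (auto simp: step_def split: if_splits)

lemma step_le:
  fixes s :: "'w::finite config"
  assumes "s' \<in> set_pmf (step \<tau> P s)" "s \<in> configs"
  shows "s' w \<le> b - 1"
  using assms(1) by (cases rule: step_cases) (use assms(2) in \<open>auto simp: configs_def diff_le_mono\<close>)

text \<open>Each busy worker loses one unit, idle ones stay at 0 by truncated subtraction, and the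
  taker gains \<open>b - 1\<close>.\<close>

lemma step_drift:
  fixes s :: "'w::finite config"
  assumes "s' \<in> set_pmf (step \<tau> P s)"
  shows "real (\<Sum>w\<in>UNIV. s' w) =
    real (\<Sum>w\<in>UNIV. s w) + (real (card (idle s)) - real CARD('w) + (real b - 1) * I s)"
proof -
  have dec: "real (s w - 1) = real (s w) - 1 + indicator (idle s) w" for w
    by (auto simp: idle_def indicator_def)
  have dec_sum: "(\<Sum>w\<in>UNIV. real (s w - 1)) =
      (\<Sum>w\<in>UNIV. real (s w)) - real CARD('w) + real (card (idle s))"
    unfolding dec by (simp add: sum.distrib sum_subtractf indicator_def sum.If_cases)
  show ?thesis
    using assms
  proof (cases rule: step_cases)
    case lost
    then show ?thesis
      using dec_sum by (simp add: I_def)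
  next
    case (taken w)
    have "real (s' v) = real (s v - 1) + (if v = w then real b - 1 else 0)" for v
      using taken busy_time by (auto simp: idle_def)
    then have "(\<Sum>v\<in>UNIV. real (s' v)) = (\<Sum>v\<in>UNIV. real (s v - 1)) + (real b - 1)"
      by (simp add: sum.distrib)
    then show ?thesis
      using dec_sum taken(1) by (auto simp: I_def)
  qed
qed

text \<open>
  After \<open>j\<close> steps, residual times above \<open>b - j\<close> stem from orders of different steps.
\<close>

definition distinct_from :: "nat \<Rightarrow> 'w config \<Rightarrow> bool" where
  "distinct_from j s \<longleftrightarrow> (\<forall>v w. v \<noteq> w \<longrightarrow> s v = s w \<longrightarrow> 0 < s v \<longrightarrow> s v + j \<le> b)"

text \<open>Existing ties move down by one unit. A new tie at \<open>b - 1\<close> with the taker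
  needs an old residual time \<open>b\<close>, which the last hypothesis permits only for
  \<open>j = 0\<close>, where the claim holds anyway.\<close>

lemma distinct_from_step:
  fixes s :: "'w::finite config"
  assumes "s' \<in> set_pmf (step \<tau> P s)" "s \<in> configs" "distinct_from j s"
    and "j = 0 \<or> (\<forall>w. s w < b)"
  shows "distinct_from (Suc j) s'"
  unfolding distinct_from_def
proof (intro allI impI)
  fix v w
  assume vw: "v \<noteq> w" "s' v = s' w" "0 < s' v"
  have *: "s' v + Suc j \<le> b" if "s' v = s v - 1" "s' w = s w - 1"
  proof -
    have "s v = s w" "0 < s v"
      using vw that by auto
    then have "s v + j \<le> b"
      using assms(3) vw(1) by (auto simp: distinct_from_def)
    then show ?thesis
      using that vw(3) by simp
  qed
  show "s' v + Suc j \<le> b"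
    using assms(1)
  proof (cases rule: step_cases)
    case lost
    then show ?thesis
      by (intro *) auto
  next
    case (taken x)
    show ?thesis
    proof (cases "x = v \<or> x = w")
      case False
      then show ?thesis
        using taken by (intro *) auto
    next
      case True
      then obtain y where "s y - 1 = b - 1" "s' v = b - 1"
        using taken vw by fastforce
      then have "b \<le> s y"
        using vw(3) by simp
      then have "j = 0"
        using assms(4) by (meson leD)
      then show ?thesis
        using \<open>s' v = b - 1\<close> busy_time by simp
    qed
  qed
qed

text \<open>
  While two workers are idle, each step puts a new worker on the residual time \<open>b - 1\<close>; after
  \<open>b - 1\<close> such steps all busy residual times are in use.
\<close>

definition saturated_from :: "nat \<Rightarrow> 'w config \<Rightarrow> bool" where
  "saturated_from j s \<longleftrightarrow> card (idle s) \<le> 1 \<or> (\<forall>x. 0 < x \<longrightarrow> x < b \<longrightarrow> b \<le> x + j \<longrightarrow> x \<in> range s)"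

lemma saturated_from_step:
  fixes s :: "'w::finite config"
  assumes "s' \<in> set_pmf (step \<tau> P s)"
    and distinct: "\<And>v w. s v = s w \<Longrightarrow> 0 < s v \<Longrightarrow> v = w"
    and busy: "\<And>w. s w < b"
    and "saturated_from j s"
  shows "saturated_from (Suc j) s'"
proof (cases "card (idle s) \<le> 1")
  case True
  \<comment> \<open>Distinctness lets at most one busy worker become free, while a sole idle worker
    takes the order.\<close>
  have one: "card {v. s v = 1} \<le> 1"
    unfolding One_nat_def card_le_Suc0_iff_eq[OF finite] by (intro ballI distinct) auto
  have "card (idle s') \<le> 1"
    using assms(1)
  proof (cases rule: step_cases)
    case lost
    have "idle s' \<subseteq> {v. s v = 1}"
    proof
      fix v
      assume "v \<in> idle s'"
      moreover have "v \<notin> idle s"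
        using lost(1) by simp
      ultimately show "v \<in> {v. s v = 1}"
        using lost(2) by (simp add: idle_def)
    qed
    then show ?thesis
      using one card_mono[of "{v. s v = 1}" "idle s'"] by simp
  next
    case (taken w)
    have only_w: "v = w" if "v \<in> idle s" for v
      using True that taken(1) card_le_Suc0_iff_eq[of "idle s"] by simp
    have sub: "idle s' \<subseteq> insert w {v. s v = 1}"
    proof
      fix v
      assume "v \<in> idle s'"
      moreover have "v \<notin> idle s" if "v \<noteq> w"
        using only_w that by metis
      ultimately show "v \<in> insert w {v. s v = 1}"
        using taken(2) by (cases "v = w") (simp_all add: idle_def)
    qed
    show ?thesis
    \<comment> \<open>For \<open>b = 1\<close> the taker is idle again at once, but then nobody else
      becomes free.\<close>
    proof (cases "b = 1")
      case False
      then have "w \<notin> idle s'"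
        using taken busy_time by (auto simp: idle_def)
      then show ?thesis
        using sub by (intro order.trans[OF card_mono one]) auto
    next
      case b1: True
      have "s v \<noteq> 1" for v
        using busy[of v] b1 by simp
      then have "idle s' \<subseteq> {w}"
        using sub by blast
      then show ?thesis
        using card_mono[of "{w}" "idle s'"] by simp
    qed
  qed
  then show ?thesis
    by (simp add: saturated_from_def)
next
  case False
  then have idle: "idle s \<noteq> {}"
    by auto
  have "x \<in> range s'" if x: "0 < x" "x < b" "b \<le> x + Suc j" for x
    using assms(1)
  proof (cases rule: step_cases)
    case lost
    then show ?thesis
      using idle by simp
  next
    case (taken w)
    show ?thesis
    \<comment> \<open>The taker occupies \<open>b - 1\<close>; every smaller value is inherited from
      \<open>x + 1\<close>.\<close>
    proof (cases "x = b - 1")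
      case True
      then show ?thesis
        using taken(2) by (intro image_eqI[of _ _ w]) auto
    next
      case False
      then have "x + 1 \<in> range s"
        using \<open>saturated_from j s\<close> \<open>\<not> card (idle s) \<le> 1\<close> x by (simp add: saturated_from_def)
      then obtain v where "x + 1 = s v"
        by blast
      then show ?thesis
        using taken by (intro image_eqI[of _ _ v]) (auto simp: idle_def)
    qed
  qed
  then show ?thesis
    by (simp add: saturated_from_def)
qed

text \<open>Pigeonhole: two idle workers together with a busy worker for each of the
  \<open>b - 1\<close> positive residual times would make \<open>b + 1\<close> workers.\<close>

lemma saturated_imp_card_idle_le_1:
  fixes s :: "'w::finite config"
  assumes "CARD('w) \<le> b" "saturated_from j s" "b \<le> Suc j"
  shows "card (idle s) \<le> 1"
proof (rule ccontr)
  assume "\<not> card (idle s) \<le> 1"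
  have "{0<..<b} \<subseteq> s ` (- idle s)"
  proof
    fix x
    assume x: "x \<in> {0<..<b}"
    then have "x \<in> range s"
      using \<open>\<not> card (idle s) \<le> 1\<close> assms(2,3) by (simp add: saturated_from_def)
    then obtain v where "x = s v"
      by blast
    then show "x \<in> s ` (- idle s)"
      using x by (simp add: idle_def)
  qed
  then have "b - 1 \<le> card (- idle s)"
    using surj_card_le[of "- idle s" "{0<..<b}" s] by simp
  moreover have "card (- idle s) = CARD('w) - card (idle s)"
    by (simp add: Compl_eq_Diff_UNIV card_Diff_subset)
  moreover have "card (idle s) \<le> CARD('w)"
    by (intro card_mono) auto
  ultimately show False
    using \<open>\<not> card (idle s) \<le> 1\<close> assms(1) busy_time by linarith
qed

text \<open>Pigeonhole in the other direction: if all workers were busy, their distinct residual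
  times would have to fit into the \<open>b - 1\<close> values below \<open>b\<close>.\<close>

lemma distinct_imp_idle:
  fixes s :: "'w::finite config"
  assumes "b \<le> CARD('w)"
    and "\<And>v w. s v = s w \<Longrightarrow> 0 < s v \<Longrightarrow> v = w"
    and "\<And>w. s w < b"
  shows "idle s \<noteq> {}"
proof
  assume "idle s = {}"
  then have pos: "0 < s w" for w
    by (auto simp: idle_def)
  then have "inj s"
    using assms(2) by (auto intro: injI)
  moreover have "range s \<subseteq> {0<..<b}"
    using pos assms(3) by auto
  ultimately have "CARD('w) \<le> b - 1"
    using card_inj_on_le[of s UNIV "{0<..<b}"] by simp
  then show False
    using assms(1) busy_time by simp
qed

end

section \<open>Long-run averages of a run\<close>

locale order_run = order_model b r \<delta> c m n
  for b :: nat and r \<delta> c m n :: real +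
  fixes \<tau> :: real and P :: "'w::finite set" and s0 :: "'w config"
  assumes init_le: "s0 w \<le> b"
begin

sublocale chain: finite_markov_chain "step \<tau> P" configs s0
proof
  show "s0 \<in> configs"
    using init_le by (simp add: configs_def)
  show "set_pmf (step \<tau> P s) \<subseteq> configs" if "s \<in> configs" for s :: "'w config"
    using step_le[OF _ that] by (fastforce simp: configs_def intro: order.trans)
qed (rule finite_configs)

text \<open>Step \<open>t\<close> of the model is time \<open>t - 1\<close> of the chain. By
  \<open>avg_convergent\<close> the \<open>lim\<close> in \<open>long_run_avg\<close> is therefore a
  genuine limit.\<close>

lemma Et_eq_lim_avg: "Et \<tau> P s0 X = chain.lim_avg X"
proof -
  have "(\<Sum>t=1..T. measure_pmf.expectation (config_at \<tau> P s0 t) X) = (\<Sum>t<T. chain.expect t X)" for T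
    by (rule sum.reindex_bij_witness[of _ Suc "\<lambda>t. t - 1"])
      (auto simp: config_at_def chain.law_def)
  then show ?thesis
    by (simp add: Et_def long_run_avg_def chain.lim_avg_def chain.avg_def[abs_def])
qed

lemma law_distinct:
  assumes "s \<in> set_pmf (chain.law t)"
  shows "distinct_from t s \<and> (t > 0 \<longrightarrow> (\<forall>w. s w < b))"
  using assms
proof (induction rule: chain.set_law_induct)
  case init
  show ?case
    using init_le by (simp add: distinct_from_def)
next
  case (step t s s')
  have "s' w < b" for w
    using step_le[OF step(2,1), of w] busy_time by simp
  then show ?case
    using distinct_from_step[OF step(2,1)] step(3) by blast
qed

text \<open>From time \<open>b\<close> on, a tie of positive residual times would violate
  \<open>s v + t \<le> b\<close>.\<close>

lemma law_late:
  assumes "s \<in> set_pmf (chain.law t)" "b \<le> t"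
  shows "s v = s w \<Longrightarrow> 0 < s v \<Longrightarrow> v = w" and "s w < b"
  using law_distinct[OF assms(1)] assms(2) busy_time by (fastforce simp: distinct_from_def)+

text \<open>The count \<open>j\<close> starts at time \<open>b\<close>, when ties are excluded; for
  \<open>j = 0\<close> the range \<open>b \<le> x < b\<close> is empty.\<close>

lemma law_saturated:
  assumes "s \<in> set_pmf (chain.law (b + j))"
  shows "saturated_from j s"
  using assms
proof (induction j arbitrary: s)
  case 0
  then show ?case
    by (simp add: saturated_from_def)
next
  case (Suc j)
  then obtain s1 where s1: "s1 \<in> set_pmf (chain.law (b + j))" "s \<in> set_pmf (step \<tau> P s1)"
    by auto
  show ?case
    by (rule saturated_from_step[OF s1(2) _ _ Suc.IH[OF s1(1)]])
      (use law_late[OF s1(1)] in auto)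
qed

text \<open>The total residual time gives the balance: mean number of idle workers plus
  \<open>b - 1\<close> times the service rate equals \<open>N\<close>. With \<open>b \<le> N\<close>
  somebody is eventually always idle; otherwise at most one worker is, so \<open>I\<close> counts
  the idle workers and the balance yields \<open>N / b\<close>.\<close>

lemma lim_avg_I: "chain.lim_avg I = min 1 (real CARD('w) / real b)"
proof -
  have W: "real (card (idle s)) - real CARD('w) + (real b - 1) * I s =
      real (card (idle s)) + ((- real CARD('w)) + (real b - 1) * I s)" for s :: "'w config"
    by simp
  let ?D = "\<lambda>s::'w config. real (card (idle s)) - real CARD('w) + (real b - 1) * I s"
  have "0 \<le> chain.lim_avg ?D"
    by (rule chain.lim_avg_drift[where W = "\<lambda>s. real (\<Sum>w\<in>UNIV. s w)"]) (simp only: step_drift)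
  moreover have "0 \<le> chain.lim_avg (\<lambda>s. (- 1) * ?D s)"
    by (rule chain.lim_avg_drift[where W = "\<lambda>s. - real (\<Sum>w\<in>UNIV. s w)"])
      (simp only: step_drift minus_add_distrib mult_minus1)
  ultimately have "chain.lim_avg ?D = 0"
    by (simp only: chain.lim_avg_mult)
  then have balance: "chain.lim_avg (\<lambda>s. real (card (idle s))) + (real b - 1) * chain.lim_avg I
      = real CARD('w)"
    unfolding W by (simp only: chain.lim_avg_add chain.lim_avg_mult chain.lim_avg_const)
  show ?thesis
  proof (cases "b \<le> CARD('w)")
    case True
    have "chain.lim_avg I = chain.lim_avg (\<lambda>s. 1)"
      by (rule chain.lim_avg_cong[of b])
        (use distinct_imp_idle[OF True] law_late in \<open>auto simp: I_def\<close>)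
    then show ?thesis
      using True busy_time by simp
  next
    case False
    \<comment> \<open>The first \<open>b\<close> steps remove ties, the next \<open>b\<close>
      saturate the residual times.\<close>
    have "I s = real (card (idle s))" if "t \<ge> 2 * b" "s \<in> set_pmf (chain.law t)" for t s
    proof -
      have "card (idle s) \<le> 1"
        using False law_saturated[of s "t - b"] that
        by (intro saturated_imp_card_idle_le_1[of "t - b"]) auto
      moreover have "card (idle s) = 0 \<longleftrightarrow> idle s = {}"
        by simp
      ultimately show ?thesis
        by (auto simp: I_def le_Suc_eq)
    qed
    then have "chain.lim_avg I = chain.lim_avg (\<lambda>s. real (card (idle s)))"
      by (intro chain.lim_avg_cong[of "2 * b"]) auto
    then have "real b * chain.lim_avg I = real CARD('w)"
      using balance by (simp add: algebra_simps)
    then show ?thesis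
      using False busy_time by (simp add: field_simps min_def)
  qed
qed

text \<open>The residual time of \<open>w\<close> drops by 1 while \<open>w\<close> is busy and
  rises by at most \<open>b - 1\<close> while \<open>w\<close> is idle; on average the rises must
  make up for the drops.\<close>

lemma lim_avg_worker_idle: "1 / real b \<le> chain.lim_avg (\<lambda>s. indicator (idle s) w)"
proof -
  have "0 \<le> chain.lim_avg (\<lambda>s. (- 1) + real b * indicator (idle s) w)"
  proof (rule chain.lim_avg_drift[where W = "\<lambda>s. real (s w)"])
    fix s s' :: "'w config"
    assume "s' \<in> set_pmf (step \<tau> P s)"
    then show "real (s' w) \<le> real (s w) + (- 1 + real b * indicator (idle s) w)"
      by (cases rule: step_cases) (use busy_time in \<open>auto simp: idle_def indicator_def of_nat_diff Suc_le_eq\<close>)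
  qed
  then show ?thesis
    using busy_time by (simp add: chain.lim_avg_add chain.lim_avg_mult field_simps
        del: mult_minus1 uminus_add_conv_diff)
qed

end

section \<open>Lower bound on the expected pay increase\<close>

context order_model
begin

text \<open>As \<open>\<tau> - r\<close> will be \<open>Z * \<delta>\<close>, the right side is the
  whole expected increase. At least \<open>z\<close> declines have probability \<open>q^z\<close>,
  so it is a tail sum of these; its first term suffices, since \<open>q\<close> is at least
  \<open>1 / N\<close> when participant \<open>w\<close> is idle.\<close>

lemma pay_increase_ge:
  fixes P :: "'w::finite set" and s :: "'w config"
  assumes "0 < Z \<tau>" "w \<in> P"
  shows "\<delta> / real CARD('w) * indicator (idle s) w \<le>
    real (Z \<tau>) * \<delta> * (\<beta> \<tau> P s * I s) + (1 - \<beta> \<tau> P s) * R \<tau> P s * I s"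
proof (cases "idle s = {}")
  case True
  then show ?thesis
    by (simp add: I_def)
next
  case False
  define x where "x = q P s"
  have "card (idle s \<inter> P) \<le> card (idle s)" "0 < card (idle s)"
    using False by (auto intro: card_mono simp: card_gt_0_iff)
  then have x: "0 \<le> x" "x \<le> 1"
    by (auto simp: x_def q_def)
  have "indicator (idle s) w / real CARD('w) \<le> x"
  proof (cases "w \<in> idle s")
    case True
    then have "1 \<le> card (idle s \<inter> P)"
      using assms(2) by (auto simp: Suc_le_eq card_gt_0_iff)
    moreover have "card (idle s) \<le> CARD('w)"
      by (intro card_mono) auto
    ultimately show ?thesis
      using True \<open>0 < card (idle s)\<close> unfolding x_def q_def
      by (auto intro!: frac_le)
  qed (use x in simp)
  then have "\<delta> / real CARD('w) * indicator (idle s) w \<le> \<delta> * x"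
    using mult_left_mono[of _ x \<delta>] increment by fastforce
  also have "\<dots> \<le> real (Z \<tau>) * \<delta> * x ^ (Z \<tau> + 1) + (1 - x ^ (Z \<tau> + 1)) * R \<tau> P s"
  \<comment> \<open>Here the factor of \<open>R\<close> is 0, whatever value the division by zero
    gives.\<close>
  proof (cases "x = 1")
    case True
    then show ?thesis
      using assms(1) increment by simp
  next
    case False
    then have "x < 1"
      using x by simp
    then have nz: "x ^ (Z \<tau> + 1) \<noteq> 1"
      using x power_decreasing[of 1 "Z \<tau> + 1" x] by auto
    have "(1 - x ^ (Z \<tau> + 1)) * R \<tau> P s = \<delta> * (\<Sum>z\<le>Z \<tau>. real z * (x ^ z * (1 - x)))"
      unfolding R_def x_def[symmetric] sum_distrib_left using nz by (intro sum.cong) auto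
    \<comment> \<open>Summation by parts; for \<open>k = Z\<close> the subtracted boundary term
      cancels against the participants' share.\<close>
    also have "(\<Sum>z\<le>k. real z * (x ^ z * (1 - x))) = (\<Sum>z=1..k. x ^ z) - real k * x ^ (k + 1)" for k
      by (induction k) (auto simp: algebra_simps)
    finally have "real (Z \<tau>) * \<delta> * x ^ (Z \<tau> + 1) + (1 - x ^ (Z \<tau> + 1)) * R \<tau> P s =
        \<delta> * (\<Sum>z=1..Z \<tau>. x ^ z)"
      by (simp add: algebra_simps)
    moreover have "x \<le> (\<Sum>z=1..Z \<tau>. x ^ z)"
      using assms(1) x member_le_sum[of 1 "{1..Z \<tau>}" "\<lambda>z. x ^ z"] by simp
    ultimately show ?thesis
      using increment by simp
  qed
  finally show ?thesis
    using False by (simp add: I_def \<beta>_def x_def)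
qed

end

section \<open>Positivity of the gain\<close>

theorem theorem1:
  fixes b :: nat and r \<delta> c m n \<alpha> \<tau> :: real
    and P :: "'w::finite set" and s0 s0_base :: "'w config"
  assumes "order_model b r \<delta> c m n"
    and "0 < \<alpha>" and "\<alpha> \<le> 1" and "\<alpha> * real CARD('w) \<in> \<nat>"
    and "real (card P) = \<alpha> * real CARD('w)"
    and "\<tau> > r" and "(\<tau> - r) / \<delta> \<in> \<nat>"
    and "\<forall>w. s0 w \<le> b" and "\<forall>w. s0_base w \<le> b"
  shows "order_model.gain b r \<delta> c m n \<tau> P s0 s0_base > 0"
proof -
  interpret order_model b r \<delta> c m n
    by fact
  interpret run: order_run b r \<delta> c m n \<tau> P s0
    by unfold_locales (use assms in simp)
  interpret base: order_run b r \<delta> c m n r "{}" s0_base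
    by unfold_locales (use assms in simp)
  define N where "N = real CARD('w)"
  have N: "N > 0"
    by (simp add: N_def)
  have frac: "frac P = \<alpha>"
    using assms(5) N by (simp add: frac_def N_def)
  obtain k where k: "(\<tau> - r) / \<delta> = real k"
    using assms(7) by (elim Nats_cases)
  then have Z: "Z \<tau> = k" "\<tau> - r = real k * \<delta>"
    using increment by (auto simp: Z_def field_simps)
  then have "0 < Z \<tau>"
    using assms(6) by (cases "k = 0") auto
  obtain w where "w \<in> P"
    using assms(2,5) N by (cases "P = {}") (auto simp: N_def)
  define B where "B = run.chain.lim_avg (\<lambda>s. \<beta> \<tau> P s * I s)"
  define A where "A = run.chain.lim_avg (\<lambda>s. (1 - \<beta> \<tau> P s) * I s)"
  define Q where "Q = run.chain.lim_avg (\<lambda>s. (1 - \<beta> \<tau> P s) * R \<tau> P s * I s)"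
  have "u \<tau> P s0 = n / N * ((\<tau> - c * m) * B + (r - c * m) * A + Q)"
  \<comment> \<open>With only participants, \<open>uA\<close> divides by zero but has weight 0, and
    \<open>q = 1\<close> whenever somebody is idle makes \<open>A\<close> and \<open>Q\<close>
    vanish.\<close>
  proof (cases "\<alpha> = 1")
    case True
    then have "card P = card (UNIV :: 'w set)"
      using assms(5) by simp
    then have "P = UNIV"
      by (intro card_subset_eq) auto
    then have "(1 - \<beta> \<tau> P s) * I s = 0" "(1 - \<beta> \<tau> P s) * R \<tau> P s * I s = 0"
      for s :: "'w config"
      by (auto simp: \<beta>_def q_def I_def)
    then have "A = 0" "Q = 0"
      by (simp_all only: A_def Q_def run.chain.lim_avg_const)
    then show ?thesis
      using True by (simp add: u_def uD_def frac run.Et_eq_lim_avg B_def N_def)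
  next
    case False
    have scale: "a * (1 / (a * N) * x * n * y) = n / N * (x * y)"
      "a * (n / (a * N) * y) = n / N * y" if "a \<noteq> 0" for a x y
      using that by simp_all
    have "u \<tau> P s0 = \<alpha> * (1 / (\<alpha> * N) * (\<tau> - c * m) * n * B) +
        (1 - \<alpha>) * (1 / ((1 - \<alpha>) * N) * (r - c * m) * n * A + n / ((1 - \<alpha>) * N) * Q)"
      by (simp only: u_def uD_def uA_def frac run.Et_eq_lim_avg A_def B_def Q_def N_def)
    also have "\<dots> = n / N * ((\<tau> - c * m) * B) + (n / N * ((r - c * m) * A) + n / N * Q)"
      using False assms(2) by (simp only: distrib_left scale)
    finally show ?thesis
      by (simp only: distrib_left add.assoc)
  qed
  \<comment> \<open>The base run serves orders at the same rate, because the value in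
    \<open>lim_avg_I\<close> depends only on \<open>N\<close> and \<open>b\<close>.\<close>
  moreover have "u_base s0_base = n / N * ((r - c * m) * (A + B))"
  proof -
    have "A + B = run.chain.lim_avg I"
      unfolding A_def B_def run.chain.lim_avg_add[symmetric] by (simp add: algebra_simps)
    then show ?thesis
      by (simp add: u_base_def base.Et_eq_lim_avg base.lim_avg_I run.lim_avg_I N_def)
  qed
  ultimately have "gain \<tau> P s0 s0_base = n / N * ((\<tau> - r) * B + Q)"
    by (simp add: gain_def algebra_simps)
  moreover have "0 < (\<tau> - r) * B + Q"
  proof -
    \<comment> \<open>A participant is idle at least a fraction \<open>1 / b\<close> of the time,
      and each such step adds at least \<open>\<delta> / N\<close> to the expected pay.\<close>
    have "0 < \<delta> / N * (1 / real b)"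
      using increment busy_time N by simp
    also have "\<dots> \<le> \<delta> / N * run.chain.lim_avg (\<lambda>s. indicator (idle s) w)"
      using increment N by (intro mult_left_mono run.lim_avg_worker_idle) simp
    also have "\<dots> \<le> (\<tau> - r) * B + Q"
      unfolding B_def Q_def run.chain.lim_avg_mult[symmetric] run.chain.lim_avg_add[symmetric]
      using pay_increase_ge[OF \<open>0 < Z \<tau>\<close> \<open>w \<in> P\<close>] unfolding Z N_def
      by (intro run.chain.lim_avg_mono[of 0]) simp
    finally show ?thesis .
  qed
  ultimately show ?thesis
    using orders_per_hour N by simp
qed

end
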